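(* For every integer $n\ge 1$, $$ \overline{SOME}(n)\equiv \begin{cases} 2 \pmod 8, & \text{if } n \text{ is an odd perfect square},\\ 0 \pmod 8, & \text{otherwise}. \end{cases} $$
   Context: An overpartition of a positive integer $n$ is a partition of $n$ in which the first occurrence of each part size may be overlined. $\overline{SOME}(n)$ is the sum of all odd parts minus the sum of all even parts, taken over all overpartitions of $n$ (parts counted with multiplicity, overlined or not). *)

theory Defs
  imports
    "HOL-Library.Multiset"
    "HOL-Computational_Algebra.Nth_Powers"
    "HOL-Number_Theory.Cong"
begin

definition partitions :: "nat \<Rightarrow> nat multiset set" where
  "partitions n = {P. 0 \<notin># P \<and> \<Sum>\<^sub># P = n}"

text \<open>
  Only the first occurrence of each part size may be overlined, so an overpartition is
  determined by the underlying partition \<open>P\<close> and the set \<open>S\<close> of those part sizes of \<open>P\<close>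
  whose first occurrence is overlined.
\<close>
definition overpartitions :: "nat \<Rightarrow> (nat multiset \<times> nat set) set" where
  "overpartitions n = {(P, S). P \<in> partitions n \<and> S \<subseteq> set_mset P}"

text \<open>
  All parts count with multiplicity, and overlined parts count like the others, so the
  overlining affects only the number of times \<open>P\<close> contributes.
\<close>
definition SOME_over :: "nat \<Rightarrow> int" where
  "SOME_over n = (\<Sum>(P, S)\<in>overpartitions n.
     int (\<Sum>\<^sub># (filter_mset odd P)) - int (\<Sum>\<^sub># (filter_mset even P)))"

text \<open>The sum defining \<^const>\<open>SOME_over\<close> is over a finite set.\<close>

lemma finite_partitions: "finite (partitions n)"
proof (rule finite_subset)
  show "partitions n \<subseteq> (\<Union>k\<le>n. multisets_of_size {..n} k)"
  proof
    fix P assume "P \<in> partitions n"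
    then have pos: "0 \<notin># P" and sum: "\<Sum>\<^sub># P = n" by (auto simp: partitions_def)
    have "size P \<le> \<Sum>\<^sub># P" using pos by (induction P) (auto simp: Suc_le_eq)
    moreover have "x \<le> n" if "x \<in># P" for x
      using multi_member_split[OF that] sum by auto
    ultimately show "P \<in> (\<Union>k\<le>n. multisets_of_size {..n} k)"
      using sum by (auto simp: multisets_of_size_def)
  qed
  show "finite (\<Union>k\<le>n. multisets_of_size {..n} k)"
    by (auto intro!: finite_multisets_of_size)
qed

lemma finite_overpartitions: "finite (overpartitions n)"
proof -
  have "overpartitions n = (SIGMA P:partitions n. Pow (set_mset P))"
    by (auto simp: overpartitions_def)
  then show ?thesis by (simp add: finite_partitions)
qed

end

theory Submission
  imports Defs
begin

text \<open>
  A partition \<open>P\<close> of \<open>n\<close> with \<open>c\<close> distinct part sizes underlies \<open>2\<^sup>c\<close> overpartitions, so modulo 8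
  only \<open>c \<le> 2\<close> matters, and the sum is congruent to \<open>2 n \<tau>(n) + 4 n N(n)\<close>, where \<open>N(n)\<close> counts the
  partitions of \<open>n\<close> with exactly two part sizes. Conjugation is an involution on those partitions.
  For odd \<open>n\<close> its fixed points correspond to the divisors \<open>b\<close> of \<open>n\<close> with \<open>b\<^sup>2 < n\<close>; let there be \<open>h\<close>
  of them. Then \<open>N(n) \<equiv> h (mod 2)\<close>, while \<open>\<tau>(n)\<close> is \<open>2 h\<close>, plus 1 if \<open>n\<close> is a square. The
  contributions of \<open>h\<close> cancel modulo 8 and only the square term survives.
\<close>

section \<open>Parity under an involution, and the number of divisors\<close>

text \<open>The points moved by \<open>f\<close> split into pairs \<open>{x, f x}\<close>. The
  induction deletes one such pair at a time, which keeps the parity of the cardinality and all fixed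
  points.\<close>

lemma even_card_involution_iff:
  assumes "finite A" and "\<And>x. x \<in> A \<Longrightarrow> f x \<in> A" and "\<And>x. x \<in> A \<Longrightarrow> f (f x) = x"
  shows "even (card A) \<longleftrightarrow> even (card {x \<in> A. f x = x})"
  using assms
proof (induction A rule: finite_psubset_induct)
  case (psubset A)
  show ?case
  proof (cases "\<exists>x\<in>A. f x \<noteq> x")
    case False
    then have "{x \<in> A. f x = x} = A" by auto
    then show ?thesis by simp
  next
    case True
    then obtain x where x: "x \<in> A" "f x \<noteq> x" by blast
    define B where "B = A - {x, f x}"
    have fx: "f x \<in> A" "f (f x) = x" using x psubset.prems by auto
    have inv_B: "f y \<in> B" "f (f y) = y" if "y \<in> B" for y
    proof -
      have y: "y \<in> A" "y \<noteq> x" "y \<noteq> f x" using that by (simp_all add: B_def)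
      then show "f (f y) = y" by (intro psubset.prems)
      \<comment> \<open>Were \<open>f y\<close> one of the two deleted points, applying
        \<open>f\<close> again would make \<open>y\<close> the other one.\<close>
      then have "f y \<noteq> x" "f y \<noteq> f x" using y fx by metis+
      then show "f y \<in> B" using y psubset.prems(1) by (simp add: B_def)
    qed
    have "even (card B) \<longleftrightarrow> even (card {y \<in> B. f y = y})"
    proof (rule psubset.IH)
      show "B \<subset> A" using x by (auto simp: B_def)
    qed (fact inv_B)+
    moreover have "{y \<in> B. f y = y} = {y \<in> A. f y = y}"
      using x(2) fx(2) by (auto simp: B_def)
    moreover have "card A = card B + 2"
    proof -
      have "A = insert x (insert (f x) B)" using x(1) fx(1) unfolding B_def by blast
      moreover have "card (insert x (insert (f x) B)) = card B + 2"
        using x psubset.hyps by (simp add: B_def)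
      ultimately show ?thesis by simp
    qed
    ultimately show ?thesis by simp
  qed
qed

text \<open>Passing to the cofactor exchanges the divisors below the square root of \<open>n\<close>
  with those above it; only an integral square root is left over.\<close>

lemma card_divisors_eq:
  fixes n :: nat
  assumes "n > 0"
  shows "card {d. d dvd n} = 2 * card {d. d dvd n \<and> d\<^sup>2 < n} + of_bool (is_square n)"
proof -
  let ?S = "{d. d dvd n \<and> d\<^sup>2 < n}" and ?E = "{d. d dvd n \<and> d\<^sup>2 = n}"
  let ?L = "{d. d dvd n \<and> n < d\<^sup>2}"
  have "finite {d. d dvd n}" using assms by simp
  then have fin: "finite {d. d dvd n \<and> P d}" for P
    by (rule rev_finite_subset) blast
  have "bij_betw (\<lambda>d. n div d) ?S ?L"
  proof (rule bij_betw_byWitness[where f' = "\<lambda>d. n div d"])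
    have cofactor: "n div d dvd n \<and> n div (n div d) = d \<and>
        (n < (n div d)\<^sup>2 \<longleftrightarrow> d\<^sup>2 < n) \<and> ((n div d)\<^sup>2 < n \<longleftrightarrow> n < d\<^sup>2)" if "d dvd n" for d
    proof -
      from that obtain e where n: "n = d * e" by (elim dvdE)
      then have "d > 0" "e > 0" using assms by auto
      then have "n div d = e" "n div e = d" "n < e\<^sup>2 \<longleftrightarrow> d\<^sup>2 < n" "e\<^sup>2 < n \<longleftrightarrow> n < d\<^sup>2"
        unfolding n power2_eq_square by simp_all
      moreover have "e dvd n" unfolding n by simp
      ultimately show ?thesis by metis
    qed
    then show "\<forall>d\<in>?S. n div (n div d) = d" "\<forall>d\<in>?L. n div (n div d) = d"
      "(\<lambda>d. n div d) ` ?S \<subseteq> ?L" "(\<lambda>d. n div d) ` ?L \<subseteq> ?S"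
      by blast+
  qed
  then have "card ?L = card ?S" by (rule bij_betw_same_card [symmetric])
  moreover have "card ?E = of_bool (is_square n)"
  proof (cases "is_square n")
    case True
    then obtain m where "n = m\<^sup>2" by (auto elim: is_nth_powerE)
    then have "?E = {m}" by auto
    then show ?thesis using True by simp
  next
    case False
    then have "?E = {}" by auto
    then show ?thesis using False by (simp only: card.empty of_bool_eq)
  qed
  moreover have "card {d. d dvd n} = card ?S + card ?E + card ?L"
  proof -
    have "{d. d dvd n} = ?S \<union> ?E \<union> ?L" by auto
    then have "card {d. d dvd n} = card (?S \<union> ?E \<union> ?L)"
      by (rule arg_cong)
    also have "\<dots> = card (?S \<union> ?E) + card ?L"
      by (rule card_Un_disjoint) (auto intro: fin)
    also have "card (?S \<union> ?E) = card ?S + card ?E"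
      by (rule card_Un_disjoint) (auto intro: fin)
    finally show ?thesis .
  qed
  ultimately show ?thesis by simp
qed

section \<open>Partitions with one or two part sizes\<close>

definition partitions_sizes :: "nat \<Rightarrow> nat \<Rightarrow> nat multiset set" where
  "partitions_sizes c n = {P \<in> partitions n. card (set_mset P) = c}"

lemma finite_partitions_sizes: "finite (partitions_sizes c n)"
  by (simp add: partitions_sizes_def finite_partitions)

lemma partitions_sizes_1:
  assumes "n > 0"
  shows "partitions_sizes 1 n = (\<lambda>d. replicate_mset (n div d) d) ` {d. d dvd n}"
proof (intro equalityI subsetI)
  fix P assume "P \<in> partitions_sizes 1 n"
  then obtain d where d: "set_mset P = {d}" and P: "P \<in> partitions n"
    by (auto simp: partitions_sizes_def card_1_singleton_iff)
  obtain k where k: "P = replicate_mset k d"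
    using set_mset_subset_singletonD[of P d] d by blast
  have "n = k * d" "d > 0" using P d by (auto simp: k partitions_def)
  then have "d dvd n" "P = replicate_mset (n div d) d" using k by simp_all
  then show "P \<in> (\<lambda>d. replicate_mset (n div d) d) ` {d. d dvd n}" by blast
next
  fix P assume "P \<in> (\<lambda>d. replicate_mset (n div d) d) ` {d. d dvd n}"
  then obtain d where "d dvd n" and P: "P = replicate_mset (n div d) d" by blast
  then show "P \<in> partitions_sizes 1 n"
    using assms by (auto simp: partitions_sizes_def partitions_def elim!: dvdE split: if_splits)
qed

lemma card_partitions_sizes_1:
  assumes "n > 0"
  shows "card (partitions_sizes 1 n) = card {d. d dvd n}"
  unfolding partitions_sizes_1[OF assms]
  by (rule card_image) (use assms in \<open>auto simp: inj_on_def replicate_mset_eq_iff elim!: dvdE\<close>)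

text \<open>
  The quadruple \<open>((b, e), (k, l))\<close> encodes the partition with \<open>k\<close> parts \<open>b + e\<close> and \<open>l\<close> parts \<open>b\<close>.
  In these coordinates conjugation exchanges the two pairs.
\<close>
definition two_size_data :: "nat \<Rightarrow> ((nat \<times> nat) \<times> nat \<times> nat) set" where
  "two_size_data n = {((b, e), (k, l)).
     0 < b \<and> 0 < e \<and> 0 < k \<and> 0 < l \<and> k * (b + e) + l * b = n}"

definition two_size_mset :: "(nat \<times> nat) \<times> nat \<times> nat \<Rightarrow> nat multiset" where
  "two_size_mset = (\<lambda>((b, e), (k, l)). replicate_mset k (b + e) + replicate_mset l b)"

lemma bij_betw_two_size:
  "bij_betw two_size_mset (two_size_data n) (partitions_sizes 2 n)"
  unfolding bij_betw_def
proof (intro conjI equalityI subsetI)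
  show "inj_on two_size_mset (two_size_data n)"
  proof (rule inj_onI)
    fix x y
    assume "x \<in> two_size_data n" "y \<in> two_size_data n" "two_size_mset x = two_size_mset y"
    moreover obtain b e k l b' e' k' l' where xy: "x = ((b, e), k, l)" "y = ((b', e'), k', l')"
      by (metis surj_pair)
    ultimately have eq: "two_size_mset ((b, e), k, l) = two_size_mset ((b', e'), k', l')"
      and pos: "0 < b" "0 < e" "0 < k" "0 < l" "0 < b'" "0 < e'" "0 < k'" "0 < l'"
      by (auto simp: two_size_data_def)
    \<comment> \<open>As \<open>e\<close> and \<open>e'\<close> are positive, the two sizes differ,
      so counts give the multiplicities once the sets of part sizes have identified \<open>b\<close>
      and \<open>e\<close>.\<close>
    have count: "count (two_size_mset ((b, e), k, l)) x = (if x = b + e then k else if x = b then l else 0)"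
      "count (two_size_mset ((b', e'), k', l')) x = (if x = b' + e' then k' else if x = b' then l' else 0)" for x
      using pos by (simp_all add: two_size_mset_def)
    have "set_mset (two_size_mset ((b, e), k, l)) = {b, b + e}"
      "set_mset (two_size_mset ((b', e'), k', l')) = {b', b' + e'}"
      using pos by (auto simp: two_size_mset_def)
    then have "{b, b + e} = {b', b' + e'}" using eq by simp
    then have be: "b = b'" "e = e'" using pos by (auto simp: doubleton_eq_iff)
    have "k = k'" using count[of "b + e"] be eq by simp
    moreover have "l = l'" using count[of b] be eq pos by simp
    ultimately show "x = y" using be by (simp add: xy)
  qed
next
  fix P assume "P \<in> two_size_mset ` two_size_data n"
  then obtain b e k l where "((b, e), k, l) \<in> two_size_data n"
    and P: "P = replicate_mset k (b + e) + replicate_mset l b"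
    by (auto simp: two_size_mset_def)
  then have pos: "0 < b" "0 < e" "0 < k" "0 < l" and "k * (b + e) + l * b = n"
    by (auto simp: two_size_data_def)
  moreover have "set_mset P = {b, b + e}" using pos by (auto simp: P)
  ultimately show "P \<in> partitions_sizes 2 n"
    by (auto simp: partitions_sizes_def partitions_def P)
next
  fix P assume "P \<in> partitions_sizes 2 n"
  then have P: "P \<in> partitions n" and "card (set_mset P) = 2"
    by (auto simp: partitions_sizes_def)
  then obtain b a where ab: "set_mset P = {b, a}" "b < a"
    by (metis card_2_iff insert_commute linorder_neqE_nat)
  define k l where "k = count P a" and "l = count P b"
  have eq: "P = replicate_mset k a + replicate_mset l b"
  proof (rule multiset_eqI)
    fix x
    have "count P x = 0" if "x \<noteq> a" "x \<noteq> b"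
      using that ab by (metis count_eq_zero_iff insert_iff empty_iff)
    then show "count P x = count (replicate_mset k a + replicate_mset l b) x"
      using ab by (auto simp: k_def l_def)
  qed
  have "k > 0" "l > 0" using ab by (auto simp: k_def l_def)
  moreover have "b > 0" using P ab by (auto simp: partitions_def intro: Nat.gr0I)
  moreover have "k * a + l * b = n" using P unfolding partitions_def by (simp add: eq)
  ultimately have "((b, a - b), (k, l)) \<in> two_size_data n"
    using ab by (simp add: two_size_data_def)
  moreover have "two_size_mset ((b, a - b), (k, l)) = P"
    using ab eq by (simp add: two_size_mset_def)
  ultimately show "P \<in> two_size_mset ` two_size_data n" by force
qed

section \<open>Conjugation of partitions with two part sizes\<close>

text \<open>These are the self-conjugate data. The factored form shows \<open>b\<close> as a divisor
  of \<open>n\<close> whose cofactor exceeds it by a positive even number.\<close>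

lemma two_size_data_diagonal:
  "((b, e), (b, e)) \<in> two_size_data n \<longleftrightarrow> 0 < b \<and> 0 < e \<and> b * (b + 2 * e) = n"
proof -
  have "b * (b + e) + e * b = b * (b + 2 * e)" by (simp add: algebra_simps)
  then show ?thesis by (auto simp: two_size_data_def)
qed

lemma even_card_partitions_sizes_2_iff:
  assumes "odd n"
  shows "even (card (partitions_sizes 2 n)) \<longleftrightarrow> even (card {d. d dvd n \<and> d\<^sup>2 < n})"
proof -
  have fixed: "prod.swap x = x \<longleftrightarrow> (\<exists>b e. x = ((b, e), (b, e)))" for x :: "(nat \<times> nat) \<times> nat \<times> nat"
    by (metis prod.swap_def prod.collapse fst_conv snd_conv)
  have "finite (two_size_data n)"
    using bij_betw_finite[OF bij_betw_two_size] finite_partitions_sizes by blast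
  \<comment> \<open>Expanded, the total is \<open>k * b + k * e + l * b\<close>, which is symmetric
    under exchanging \<open>(b, e)\<close> with \<open>(k, l)\<close>.\<close>
  then have "even (card (two_size_data n)) \<longleftrightarrow>
      even (card {x \<in> two_size_data n. prod.swap x = x})"
    by (rule even_card_involution_iff) (auto simp: two_size_data_def algebra_simps)
  moreover have "bij_betw (\<lambda>x. fst (fst x)) {x \<in> two_size_data n. prod.swap x = x}
      {d. d dvd n \<and> d\<^sup>2 < n}"
    unfolding bij_betw_def
  proof (intro conjI equalityI subsetI)
    show "inj_on (\<lambda>x. fst (fst x)) {x \<in> two_size_data n. prod.swap x = x}"
    proof (rule inj_onI)
      fix x y
      assume "x \<in> {x \<in> two_size_data n. prod.swap x = x}"
        "y \<in> {x \<in> two_size_data n. prod.swap x = x}" "fst (fst x) = fst (fst y)"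
      moreover from this obtain b e e' where xy: "x = ((b, e), b, e)" "y = ((b, e'), b, e')"
        by (auto simp: fixed)
      ultimately have "0 < b" "b * (b + 2 * e) = n" "b * (b + 2 * e') = n"
        using two_size_data_diagonal by blast+
      then have "b + 2 * e = b + 2 * e'" by (metis mult_left_cancel not_gr_zero)
      then show "x = y" by (simp add: xy)
    qed
  next
    fix d assume "d \<in> (\<lambda>x. fst (fst x)) ` {x \<in> two_size_data n. prod.swap x = x}"
    then obtain e where "((d, e), (d, e)) \<in> two_size_data n" by (auto simp: fixed)
    then show "d \<in> {d. d dvd n \<and> d\<^sup>2 < n}"
      by (auto simp: two_size_data_diagonal power2_eq_square)
  next
    fix d assume "d \<in> {d. d dvd n \<and> d\<^sup>2 < n}"
    then obtain c where n: "n = d * c" and "d * d < d * c"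
      by (auto simp: power2_eq_square elim!: dvdE)
    then have "0 < d" "d < c" by auto
    \<comment> \<open>Both \<open>d\<close> and \<open>c\<close> divide the odd number
      \<open>n\<close>, so both are odd; half their difference is the gap \<open>e\<close>.\<close>
    have "even (c - d)" using assms \<open>d < c\<close> by (simp add: n)
    then obtain e where "c - d = 2 * e" by (elim evenE)
    then have "c = d + 2 * e" "0 < e" using \<open>d < c\<close> by auto
    then have "((d, e), (d, e)) \<in> two_size_data n"
      using \<open>0 < d\<close> by (simp add: two_size_data_diagonal n)
    then show "d \<in> (\<lambda>x. fst (fst x)) ` {x \<in> two_size_data n. prod.swap x = x}"
      by force
  qed
  then have "card {x \<in> two_size_data n. prod.swap x = x} = card {d. d dvd n \<and> d\<^sup>2 < n}"
    by (rule bij_betw_same_card)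
  moreover have "card (two_size_data n) = card (partitions_sizes 2 n)"
    using bij_betw_two_size by (rule bij_betw_same_card)
  ultimately show ?thesis by simp
qed

section \<open>Reduction of the sum modulo 8\<close>

definition odd_minus_even :: "nat multiset \<Rightarrow> int" where
  "odd_minus_even P = int (\<Sum>\<^sub># (filter_mset odd P)) - int (\<Sum>\<^sub># (filter_mset even P))"

lemma SOME_over_eq:
  "SOME_over n = (\<Sum>P\<in>partitions n. 2 ^ card (set_mset P) * odd_minus_even P)"
proof -
  have "overpartitions n = (SIGMA P:partitions n. Pow (set_mset P))"
    by (auto simp: overpartitions_def)
  then have "SOME_over n = (\<Sum>(P, S)\<in>(SIGMA P:partitions n. Pow (set_mset P)). odd_minus_even P)"
    by (simp only: SOME_over_def odd_minus_even_def)
  also have "\<dots> = (\<Sum>P\<in>partitions n. \<Sum>S\<in>Pow (set_mset P). odd_minus_even P)"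
    by (rule sum.Sigma [symmetric]) (simp_all add: finite_partitions)
  finally show ?thesis by (simp add: card_Pow)
qed

text \<open>This form makes the value visibly congruent to \<open>n\<close> modulo 2, which is all
  that matters under the weight 4 of two part sizes.\<close>

lemma odd_minus_even_partition:
  assumes "P \<in> partitions n"
  shows "odd_minus_even P = int n - 2 * int (\<Sum>\<^sub># (filter_mset even P))"
proof -
  have "\<Sum>\<^sub># P = \<Sum>\<^sub># (filter_mset odd P) + \<Sum>\<^sub># (filter_mset even P)"
    using multiset_partition[of P odd] by (metis sum_mset.union)
  moreover have "\<Sum>\<^sub># P = n" using assms by (simp add: partitions_def)
  ultimately show ?thesis unfolding odd_minus_even_def by linarith
qed

text \<open>All parts are equal, so the value is \<open>n\<close> or \<open>- n\<close>. The minus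
  sign needs an even part size; then \<open>n\<close> is even too, and \<open>2 * n\<close> and
  \<open>- 2 * n\<close> differ by a multiple of 8.\<close>

lemma odd_minus_even_one_size:
  assumes "n > 0" and "P \<in> partitions_sizes 1 n"
  shows "[2 * odd_minus_even P = 2 * int n] (mod 8)"
proof -
  obtain d where d: "d dvd n" and P: "P = replicate_mset (n div d) d"
    using assms partitions_sizes_1 by auto
  have "filter_mset even P = (if even d then P else {#})"
    by (simp add: P filter_mset_eq_conv)
  then have "\<Sum>\<^sub># (filter_mset even P) = (if even d then n else 0)"
    using d by (simp add: P)
  moreover have "P \<in> partitions n" using assms by (simp add: partitions_sizes_def)
  ultimately have "odd_minus_even P = (if even d then - int n else int n)"
    by (simp add: odd_minus_even_partition)
  moreover have "8 dvd 4 * int n" if "even d" using that d by fastforce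
  ultimately show ?thesis by (auto simp: cong_iff_dvd_diff)
qed

text \<open>The indicators merge the cases into one summand: each nonempty partition has one size,
  two sizes, or at least three, and in the last case \<open>2 ^ 3\<close> divides the
  weight.\<close>

lemma weight_cong:
  assumes "n > 0" and P: "P \<in> partitions n"
  shows "[2 ^ card (set_mset P) * odd_minus_even P =
    2 * int n * of_bool (P \<in> partitions_sizes 1 n) +
    4 * int n * of_bool (P \<in> partitions_sizes 2 n)] (mod 8)"
proof -
  have "P \<noteq> {#}" using assms by (auto simp: partitions_def)
  then have "card (set_mset P) \<noteq> 0" by simp
  then consider "card (set_mset P) = 1" | "card (set_mset P) = 2"
    | c where "card (set_mset P) = c + 3"
    by (metis One_nat_def Suc_1 add.commute not0_implies_Suc numeral_3_eq_3 add_Suc plus_nat.add_0)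
  then show ?thesis
  proof cases
    case 1
    then show ?thesis
      using odd_minus_even_one_size[OF assms(1), of P] P by (simp add: partitions_sizes_def)
  next
    case 2
    then show ?thesis
      using P by (simp add: partitions_sizes_def odd_minus_even_partition[OF P] cong_iff_dvd_diff)
  next
    case 3
    then show ?thesis
      by (simp add: partitions_sizes_def cong_0_iff power_add)
  qed
qed

lemma SOME_over_cong:
  assumes "n > 0"
  shows "[SOME_over n = 2 * int n * int (card {d. d dvd n}) +
    4 * int n * int (card (partitions_sizes 2 n))] (mod 8)"
proof -
  have "[SOME_over n = (\<Sum>P\<in>partitions n. 2 * int n * of_bool (P \<in> partitions_sizes 1 n) +
    4 * int n * of_bool (P \<in> partitions_sizes 2 n))] (mod 8)"
    unfolding SOME_over_eq using assms by (intro cong_sum weight_cong)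
  also have "(\<Sum>P\<in>partitions n. 2 * int n * of_bool (P \<in> partitions_sizes 1 n) +
    4 * int n * of_bool (P \<in> partitions_sizes 2 n)) =
    2 * int n * int (card (partitions_sizes 1 n)) + 4 * int n * int (card (partitions_sizes 2 n))"
  proof -
    have "(\<Sum>P\<in>partitions n. of_bool (P \<in> partitions_sizes c n)) = int (card (partitions_sizes c n))" for c
      by (simp add: finite_partitions partitions_sizes_def Int_def conj_commute)
    then show ?thesis by (simp add: sum.distrib flip: sum_distrib_left)
  qed
  finally show ?thesis using card_partitions_sizes_1[OF assms] by simp
qed

theorem theorem3p3:
  fixes n :: nat
  assumes "n \<ge> 1"
  shows "[SOME_over n = (if odd n \<and> is_square n then 2 else 0)] (mod 8)"
proof -
  define h where "h = int (card {d. d dvd n \<and> d\<^sup>2 < n})"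
  define N where "N = int (card (partitions_sizes 2 n))"
  have "n > 0" using assms by simp
  then have "[SOME_over n = 2 * int n * int (card {d. d dvd n}) + 4 * int n * N] (mod 8)"
    unfolding N_def by (rule SOME_over_cong)
  \<comment> \<open>The divisor count is \<open>2 * h\<close> plus the square indicator, so its main
    part joins the term in \<open>N\<close> with the common factor \<open>4 * n\<close>.\<close>
  also have "2 * int n * int (card {d. d dvd n}) + 4 * int n * N =
      4 * (int n * (h + N)) + 2 * int n * of_bool (is_square n)"
    using card_divisors_eq[OF \<open>n > 0\<close>] by (simp add: h_def algebra_simps)
  also have "[4 * (int n * (h + N)) + 2 * int n * of_bool (is_square n) =
      0 + 2 * int n * of_bool (is_square n)] (mod 8)"
  proof (rule cong_add)
    \<comment> \<open>For even \<open>n\<close> the first factor suffices; for odd \<open>n\<close>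
      the numbers \<open>h\<close> and \<open>N\<close> have equal parity.\<close>
    have "even (int n * (h + N))"
      using even_card_partitions_sizes_2_iff[of n] by (auto simp: h_def N_def)
    then show "[4 * (int n * (h + N)) = 0] (mod 8)"
      using mult_dvd_mono[of 4 4 2 "int n * (h + N)"] by (simp add: cong_0_iff)
  qed simp
  also have "[0 + 2 * int n * of_bool (is_square n) =
      (if odd n \<and> is_square n then 2 else 0)] (mod 8)"
  proof (cases "is_square n")
    case True
    \<comment> \<open>An even square is 0 and an odd square 1 modulo 4, so doubling gives 0 or 2
      modulo 8.\<close>
    then obtain m where n: "n = m\<^sup>2" by (auto elim: is_nth_powerE)
    show ?thesis
    proof (cases "even m")
      case True
      then show ?thesis using \<open>is_square n\<close>
        by (auto simp: n cong_0_iff power2_eq_square elim!: evenE)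
    next
      case False
      then obtain j where "m = 2 * j + 1" by (elim oddE)
      then have "2 * int n - 2 = 8 * (int j * int j + int j)"
        by (simp add: n power2_eq_square algebra_simps)
      then show ?thesis using \<open>is_square n\<close> False by (simp add: n cong_iff_dvd_diff)
    qed
  qed simp
  finally show ?thesis .
qed

end
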